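(* There is an absolute constant $C>0$ such that the following holds. For all $n \in \mathbb{N}$, all $g : \{0,1\}^n \to \{0,1\}$, all $k \in \mathbb{N}$ and all $\varepsilon > 0$, there exist a size bound $s \in \mathbb{N}$ with \[ n \le s \le \bigl(n + (\log(1/\varepsilon))^{C}\bigr)^{k^{1/\varepsilon^2}} \] and a function $h : \{0,1\}^n \to [0,1]$ of circuit size at most $s$ such that for every Boolean circuit $A : \{0,1\}^{n+1} \to \{0,1\}$ of size at most $s^k$, \[ \Bigl| \mathbb{E}_{x \sim \{0,1\}^n,\ y|x \sim \mathcal{B}(g(x))}[A(x,y)] - \mathbb{E}_{x \sim \{0,1\}^n,\ y|x \sim \mathcal{B}(h(x))}[A(x,y)] \Bigr| \le \varepsilon . \]
   Context: $x \sim \{0,1\}^n$ denotes a uniformly random input, and $\mathcal{B}(p)$ denotes the Bernoulli distribution with parameter $p$ (so $y=1$ with probability $p$). A Boolean circuit $c$ computes a real-valued function $h : \{0,1\}^n \to [0,1]$ in binary if there is $m \in \mathbb{N}$ such that $c$ has $n$ input bits and $m$ output bits and $h(x) = \sum_{i=1}^m c_i(x)/2^{i-1}$ for all $x$, where $c_i$ is the $i$-th output bit. The circuit size (complexity) of $h$ is the size of the smallest Boolean circuit computing it in this sense. The size of a circuit is its number of gates. *)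

theory Defs
  imports "HOL-Probability.Probability" "HOL-Library.Extended_Nat"
begin

definition cube :: "nat \<Rightarrow> bool list set" where
  "cube n = {x. length x = n}"

text \<open>
  Circuits over the De Morgan basis with fan-in two, as straight-line programs. The gates of a
  circuit are numbered: the input gates carry the numbers \<open>0, \<dots>, n_inputs - 1\<close>, and the list
  \<open>inner_gates\<close> continues this numbering. The arguments of an inner gate, and the entries of
  \<open>out_gates\<close>, are such numbers.
\<close>

datatype gate = ConstG bool | NotG nat | AndG nat nat | OrG nat nat

datatype circuit =
  Circuit (n_inputs: nat) (inner_gates: "gate list") (out_gates: "nat list")

fun gate_args :: "gate \<Rightarrow> nat set" where
  "gate_args (ConstG b) = {}"
| "gate_args (NotG i) = {i}"
| "gate_args (AndG i j) = {i, j}"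
| "gate_args (OrG i j) = {i, j}"

fun gate_value :: "bool list \<Rightarrow> gate \<Rightarrow> bool" where
  "gate_value vs (ConstG b) = b"
| "gate_value vs (NotG i) = (\<not> vs ! i)"
| "gate_value vs (AndG i j) = (vs ! i \<and> vs ! j)"
| "gate_value vs (OrG i j) = (vs ! i \<or> vs ! j)"

definition is_circuit :: "nat \<Rightarrow> nat \<Rightarrow> circuit \<Rightarrow> bool" where
  "is_circuit n m c \<longleftrightarrow>
     n_inputs c = n \<and> length (out_gates c) = m \<and>
     (\<forall>i < length (inner_gates c). \<forall>j \<in> gate_args (inner_gates c ! i). j < n + i) \<and>
     (\<forall>j \<in> set (out_gates c). j < n + length (inner_gates c))"

text \<open>
  The size is the number of all gates, input gates included (the convention in which every node of
  a circuit is a gate), so a circuit on \<open>n\<close> input bits has size at least \<open>n\<close>.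
\<close>

definition circuit_size :: "circuit \<Rightarrow> nat" where
  "circuit_size c = n_inputs c + length (inner_gates c)"

definition gate_values :: "circuit \<Rightarrow> bool list \<Rightarrow> bool list" where
  "gate_values c x = foldl (\<lambda>vs G. vs @ [gate_value vs G]) x (inner_gates c)"

definition circuit_output :: "circuit \<Rightarrow> bool list \<Rightarrow> nat \<Rightarrow> bool" where
  "circuit_output c x i = gate_values c x ! (out_gates c ! (i - 1))"
    \<comment> \<open>output bits are numbered from 1\<close>

definition computes_in_binary :: "nat \<Rightarrow> circuit \<Rightarrow> (bool list \<Rightarrow> real) \<Rightarrow> bool" where
  "computes_in_binary n c h \<longleftrightarrow>
     (\<exists>m\<ge>1. is_circuit n m c \<and>
       (\<forall>x\<in>cube n. h x = (\<Sum>i = 1..m. of_bool (circuit_output c x i) / 2 ^ (i - 1))))"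

text \<open>The value is \<open>\<infinity>\<close> if no circuit computes \<open>h\<close> in binary.\<close>

definition circuit_complexity :: "nat \<Rightarrow> (bool list \<Rightarrow> real) \<Rightarrow> enat" where
  "circuit_complexity n h = (INF c \<in> {c. computes_in_binary n c h}. enat (circuit_size c))"

definition labelled_pmf :: "nat \<Rightarrow> (bool list \<Rightarrow> real) \<Rightarrow> (bool list \<times> bool) pmf" where
  "labelled_pmf n p =
     bind_pmf (pmf_of_set (cube n)) (\<lambda>x. map_pmf (\<lambda>y. (x, y)) (bernoulli_pmf (p x)))"

definition acceptance :: "nat \<Rightarrow> circuit \<Rightarrow> (bool list \<Rightarrow> real) \<Rightarrow> real" where
  "acceptance n A p =
     measure_pmf.expectation (labelled_pmf n p)
       (\<lambda>(x, y). of_bool (circuit_output A (x @ [y]) 1))"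

end

theory Submission
  imports Defs
begin

text \<open>
  Energy increment: start from \<open>h = 1/2\<close>. If a circuit \<open>A\<close> of size at most \<open>s ^ k\<close>
  distinguishes \<open>g\<close> from \<open>h\<close> with advantage more than \<open>\<epsilon>\<close>, then \<open>g - h\<close> has correlation more than
  \<open>\<epsilon>\<close> in absolute value with \<open>A(x,1) - A(x,0)\<close>, so moving \<open>h\<close> by a step \<open>\<gamma>\<close> in that direction
  (clipped to \<open>[0,1]\<close>) lowers the mean square distance to \<open>g\<close> by at least \<open>2\<gamma>\<epsilon> - \<gamma>\<^sup>2\<close>. With the
  step \<open>\<gamma> = 2\<^sup>-\<^sup>t\<close> in \<open>(\<epsilon>/2, \<epsilon>]\<close> this is at least \<open>3\<epsilon>\<^sup>2/4\<close>, and the initial distance is \<open>1/4\<close>, so there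
  are at most \<open>1/(3\<epsilon>\<^sup>2)\<close> steps. All values of \<open>h\<close> stay multiples of \<open>\<gamma>\<close>, hence no rounding is
  needed. After \<open>i\<close> steps \<open>h\<close> is a function of the \<open>2i\<close> bits \<open>A\<^sub>j(x,0)\<close>, \<open>A\<^sub>j(x,1)\<close>, which is
  computed by brute force; a size bound of the form \<open>s\<^sub>i = s\<^sub>0 ^ k ^ (2i)\<close> is generous enough
  for this.
\<close>

subsection \<open>Sets of functions computed by a straight-line program\<close>

definition run :: "gate list \<Rightarrow> bool list \<Rightarrow> bool list" where
  "run gs x = foldl (\<lambda>vs G. vs @ [gate_value vs G]) x gs"

lemma run_Nil [simp]: "run [] x = x"
  by (simp add: run_def)

lemma run_snoc [simp]: "run (gs @ [G]) x = run gs x @ [gate_value (run gs x) G]"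
  by (simp add: run_def)

lemma length_run [simp]: "length (run gs x) = length x + length gs"
  by (induction gs rule: rev_induct) auto

definition valid_gates :: "nat \<Rightarrow> gate list \<Rightarrow> bool" where
  "valid_gates n gs \<longleftrightarrow> (\<forall>i < length gs. \<forall>j \<in> gate_args (gs ! i). j < n + i)"

lemma valid_gates_Nil [simp]: "valid_gates n []"
  by (simp add: valid_gates_def)

lemma valid_gates_snoc:
  "valid_gates n (gs @ [G]) \<longleftrightarrow> valid_gates n gs \<and> (\<forall>j \<in> gate_args G. j < n + length gs)"
  by (auto simp: valid_gates_def nth_append less_Suc_eq)

definition wire :: "nat \<Rightarrow> gate list \<Rightarrow> (bool list \<Rightarrow> bool) \<Rightarrow> bool" where
  "wire n gs f \<longleftrightarrow> (\<exists>j < n + length gs. \<forall>x\<in>cube n. run gs x ! j = f x)"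

lemma wire_snoc:
  assumes "wire n gs f"
  shows "wire n (gs @ [G]) f"
proof -
  obtain j where "j < n + length gs" "\<forall>x\<in>cube n. run gs x ! j = f x"
    using assms by (auto simp: wire_def)
  thus ?thesis
    unfolding wire_def by (intro exI[of _ j]) (auto simp: nth_append cube_def)
qed

text \<open>One program carries all of \<open>F\<close> at once, so gates are shared and gate bounds
  simply add up as functions are inserted. The program and its numbering stay hidden behind the
  existential; \<open>r\<close> counts inner gates only, inputs being free.\<close>

definition computable :: "nat \<Rightarrow> nat \<Rightarrow> (bool list \<Rightarrow> bool) set \<Rightarrow> bool" where
  "computable n r F \<longleftrightarrow> (\<exists>gs. valid_gates n gs \<and> length gs \<le> r \<and> (\<forall>f\<in>F. wire n gs f))"

lemma computable_empty: "computable n 0 {}"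
  by (auto simp: computable_def intro: exI[of _ "[]"])

lemma computable_mono:
  assumes "computable n r F" "r \<le> r'"
    "\<And>f'. f' \<in> F' \<Longrightarrow> \<exists>f\<in>F. \<forall>x\<in>cube n. f x = f' x"
  shows "computable n r' F'"
proof -
  obtain gs where gs: "valid_gates n gs" "length gs \<le> r" "\<forall>f\<in>F. wire n gs f"
    using assms(1) by (auto simp: computable_def)
  have "wire n gs f'" if "f' \<in> F'" for f'
    using assms(3)[OF that] gs(3) unfolding wire_def by metis
  thus ?thesis
    using gs assms(2) unfolding computable_def by (meson order_trans)
qed

lemma computable_subset: "computable n r F \<Longrightarrow> r \<le> r' \<Longrightarrow> F' \<subseteq> F \<Longrightarrow> computable n r' F'"
  by (rule computable_mono) auto

lemma computable_inputs:
  assumes "computable n r F"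
  shows "computable n r (F \<union> {\<lambda>x. x ! j | j. j < n})"
proof -
  obtain gs where gs: "valid_gates n gs" "length gs \<le> r" "\<forall>f\<in>F. wire n gs f"
    using assms by (auto simp: computable_def)
  have "run gs x ! j = x ! j" if "j < length x" for j x
    using that by (induction gs rule: rev_induct) (auto simp: nth_append)
  hence "wire n gs (\<lambda>x. x ! j)" if "j < n" for j
    using that unfolding wire_def by (intro exI[of _ j]) (auto simp: cube_def)
  thus ?thesis
    using gs unfolding computable_def by (intro exI[of _ gs]) auto
qed

text \<open>The program behind \<open>F\<close> is only known to exist, so a suitable gate must be
  available for every program carrying \<open>F\<close>. Appending it leaves the earlier wires
  intact.\<close>

lemma computable_gate:
  assumes "computable n r F"
    and "\<And>gs. \<forall>f\<in>F. wire n gs f \<Longrightarrow>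
      \<exists>G. (\<forall>j\<in>gate_args G. j < n + length gs) \<and> (\<forall>x\<in>cube n. gate_value (run gs x) G = f' x)"
  shows "computable n (Suc r) (insert f' F)"
proof -
  obtain gs where gs: "valid_gates n gs" "length gs \<le> r" "\<forall>f\<in>F. wire n gs f"
    using assms(1) by (auto simp: computable_def)
  obtain G where G: "\<forall>j\<in>gate_args G. j < n + length gs" "\<forall>x\<in>cube n. gate_value (run gs x) G = f' x"
    using assms(2)[OF gs(3)] by blast
  have "wire n (gs @ [G]) f'"
    unfolding wire_def using G(2)
    by (intro exI[of _ "n + length gs"]) (auto simp: nth_append cube_def)
  thus ?thesis
    using gs G(1) unfolding computable_def
    by (intro exI[of _ "gs @ [G]"]) (auto simp: valid_gates_snoc wire_snoc)
qed

section \<open>Inserting a single gate of each type\<close>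

lemma computable_const:
  assumes "computable n r F"
  shows "computable n (Suc r) (insert (\<lambda>x. b) F)"
  by (rule computable_gate[OF assms], rule exI[of _ "ConstG b"]) auto

lemma computable_not:
  assumes "computable n r F" "f \<in> F"
  shows "computable n (Suc r) (insert (\<lambda>x. \<not> f x) F)"
proof (rule computable_gate[OF assms(1)])
  fix gs assume "\<forall>f\<in>F. wire n gs f"
  then obtain i where "i < n + length gs" "\<forall>x\<in>cube n. run gs x ! i = f x"
    using assms(2) by (auto simp: wire_def)
  thus "\<exists>G. (\<forall>j\<in>gate_args G. j < n + length gs) \<and>
      (\<forall>x\<in>cube n. gate_value (run gs x) G = (\<not> f x))"
    by (intro exI[of _ "NotG i"]) auto
qed

lemma computable_and:
  assumes "computable n r F" "f \<in> F" "f' \<in> F"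
  shows "computable n (Suc r) (insert (\<lambda>x. f x \<and> f' x) F)"
proof (rule computable_gate[OF assms(1)])
  fix gs assume F: "\<forall>f\<in>F. wire n gs f"
  obtain i where "i < n + length gs" "\<forall>x\<in>cube n. run gs x ! i = f x"
    using F assms(2) by (auto simp: wire_def)
  moreover obtain j where "j < n + length gs" "\<forall>x\<in>cube n. run gs x ! j = f' x"
    using F assms(3) by (auto simp: wire_def)
  ultimately show "\<exists>G. (\<forall>j\<in>gate_args G. j < n + length gs) \<and>
      (\<forall>x\<in>cube n. gate_value (run gs x) G = (f x \<and> f' x))"
    by (intro exI[of _ "AndG i j"]) auto
qed

lemma computable_or:
  assumes "computable n r F" "f \<in> F" "f' \<in> F"
  shows "computable n (Suc r) (insert (\<lambda>x. f x \<or> f' x) F)"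
proof (rule computable_gate[OF assms(1)])
  fix gs assume F: "\<forall>f\<in>F. wire n gs f"
  obtain i where "i < n + length gs" "\<forall>x\<in>cube n. run gs x ! i = f x"
    using F assms(2) by (auto simp: wire_def)
  moreover obtain j where "j < n + length gs" "\<forall>x\<in>cube n. run gs x ! j = f' x"
    using F assms(3) by (auto simp: wire_def)
  ultimately show "\<exists>G. (\<forall>j\<in>gate_args G. j < n + length gs) \<and>
      (\<forall>x\<in>cube n. gate_value (run gs x) G = (f x \<or> f' x))"
    by (intro exI[of _ "OrG i j"]) auto
qed

text \<open>A program on \<open>n + 1\<close> inputs is replayed gate by gate on top of one for
  \<open>F\<close>, with the wire of \<open>f\<close> in the role of the last input. All positions
  are tracked, not only an output, because later gates may read any of them.\<close>

lemma computable_compose_gates: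
  assumes "computable n r F" "f \<in> F" "valid_gates (Suc n) gs"
  shows "computable n (r + length gs)
    (F \<union> {\<lambda>x. run gs (x @ [f x]) ! j | j. j < Suc n + length gs})"
  using assms(3)
proof (induction gs rule: rev_induct)
  case Nil
  show ?case
  proof (rule computable_mono[OF computable_inputs[OF assms(1)]])
    fix f' assume "f' \<in> F \<union> {\<lambda>x. run [] (x @ [f x]) ! j | j. j < Suc n + length ([] :: gate list)}"
    then consider "f' \<in> F" | j where "j < Suc n" "f' = (\<lambda>x. (x @ [f x]) ! j)"
      by auto
    thus "\<exists>f\<in>F \<union> {\<lambda>x. x ! j | j. j < n}. \<forall>x\<in>cube n. f x = f' x"
    proof cases
      case 1
      thus ?thesis by blast
    next
      case (2 j)
      show ?thesis
      proof (cases "j = n")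
        case True
        thus ?thesis using 2 assms(2) by (intro bexI[of _ f]) (auto simp: cube_def)
      next
        case False
        thus ?thesis using 2
          by (intro bexI[of _ "\<lambda>x. x ! j"]) (auto simp: cube_def nth_append)
      qed
    qed
  qed simp
next
  case (snoc G gs)
  let ?w = "\<lambda>j x. run gs (x @ [f x]) ! j"
  let ?F = "F \<union> {?w j | j. j < Suc n + length gs}"
  have IH: "computable n (r + length gs) ?F" and args: "\<forall>j\<in>gate_args G. j < Suc n + length gs"
    using snoc by (auto simp: valid_gates_snoc)
  have mem: "?w j \<in> ?F" if "j \<in> gate_args G" for j
    using args that by blast
  have "computable n (Suc (r + length gs))
      (insert (\<lambda>x. gate_value (run gs (x @ [f x])) G) ?F)"
  proof (cases G)
    case (ConstG b)
    thus ?thesis using computable_const[OF IH] by simp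
  next
    case (NotG i)
    thus ?thesis using computable_not[OF IH mem[of i]] by simp
  next
    case (AndG i j)
    thus ?thesis using computable_and[OF IH mem[of i] mem[of j]] by simp
  next
    case (OrG i j)
    thus ?thesis using computable_or[OF IH mem[of i] mem[of j]] by simp
  qed
  thus ?case
  proof (rule computable_mono)
    fix f' assume "f' \<in> F \<union> {\<lambda>x. run (gs @ [G]) (x @ [f x]) ! j | j. j < Suc n + length (gs @ [G])}"
    then consider "f' \<in> F"
      | j where "j < Suc n + length gs" "f' = (\<lambda>x. run (gs @ [G]) (x @ [f x]) ! j)"
      | "f' = (\<lambda>x. run (gs @ [G]) (x @ [f x]) ! (Suc n + length gs))"
      by (auto simp: less_Suc_eq)
    thus "\<exists>h\<in>insert (\<lambda>x. gate_value (run gs (x @ [f x])) G) ?F. \<forall>x\<in>cube n. h x = f' x"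
    proof cases
      case 1
      thus ?thesis by blast
    next
      case (2 j)
      thus ?thesis by (intro bexI[of _ "?w j"]) (auto simp: nth_append cube_def)
    next
      case 3
      thus ?thesis
        by (intro bexI[of _ "\<lambda>x. gate_value (run gs (x @ [f x])) G"]) (auto simp: nth_append cube_def)
    qed
  qed simp
qed

text \<open>A constant gate is substituted for the label. It is paid for by the label's own input
  gate, which counts in \<open>circuit_size A\<close>; hence \<open>a - n\<close> further gates
  suffice.\<close>

lemma computable_fix_last_input:
  assumes "computable n r F" "is_circuit (Suc n) 1 A" "circuit_size A \<le> a"
  shows "computable n (r + (a - n)) (insert (\<lambda>x. circuit_output A (x @ [b]) 1) F)"
proof -
  let ?gs = "inner_gates A"
  have A: "valid_gates (Suc n) ?gs" "out_gates A ! 0 < Suc n + length ?gs"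
    using assms(2) by (auto simp: is_circuit_def valid_gates_def)
  have "computable n (Suc r + length ?gs)
    (insert (\<lambda>x. b) F \<union> {\<lambda>x. run ?gs (x @ [b]) ! j | j. j < Suc n + length ?gs})"
    by (rule computable_compose_gates[OF computable_const[OF assms(1)] _ A(1)]) simp
  thus ?thesis
  proof (rule computable_subset)
    show "Suc r + length ?gs \<le> r + (a - n)"
      using assms(2,3) by (auto simp: circuit_size_def is_circuit_def)
    show "insert (\<lambda>x. circuit_output A (x @ [b]) 1) F
      \<subseteq> insert (\<lambda>x. b) F \<union> {\<lambda>x. run ?gs (x @ [b]) ! j | j. j < Suc n + length ?gs}"
      using A(2) by (auto simp: circuit_output_def gate_values_def run_def)
  qed
qed

text \<open>Shannon expansion in the first function: two smaller tables and four gates selecting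
  between them, and \<open>2 * c + 4 \<le> 6 * c\<close> for \<open>c \<ge> 1\<close>. The second
  table is built over the already enlarged set, hence the generalisation over \<open>r\<close> and
  \<open>F\<close>.\<close>

lemma computable_truth_table:
  assumes "computable n r F" "set fs \<subseteq> F"
  shows "computable n (r + 6 ^ length fs) (insert (\<lambda>x. \<phi> (map (\<lambda>f. f x) fs)) F)"
  using assms
proof (induction fs arbitrary: \<phi> r F)
  case Nil
  show ?case using computable_const[OF Nil(1), of "\<phi> []"] by simp
next
  case (Cons f fs)
  let ?p = "\<lambda>b x. \<phi> (b # map (\<lambda>f. f x) fs)"
  let ?c = "6 ^ length fs"
  let ?F1 = "insert (?p False) (insert (?p True) F)"
  let ?F2 = "insert (\<lambda>x. \<not> f x) ?F1"
  let ?F3 = "insert (\<lambda>x. \<not> f x \<and> ?p False x) ?F2"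
  let ?F4 = "insert (\<lambda>x. f x \<and> ?p True x) ?F3"
  have "computable n (r + ?c) (insert (?p True) F)"
    using Cons.prems by (intro Cons.IH) auto
  hence "computable n (r + ?c + ?c) ?F1"
    using Cons.prems by (intro Cons.IH) auto
  hence "computable n (Suc (r + ?c + ?c)) ?F2"
    by (rule computable_not) (use Cons.prems in auto)
  hence "computable n (Suc (Suc (r + ?c + ?c))) ?F3"
    by (rule computable_and) auto
  hence "computable n (Suc (Suc (Suc (r + ?c + ?c)))) ?F4"
    by (rule computable_and) (use Cons.prems in auto)
  hence "computable n (Suc (Suc (Suc (Suc (r + ?c + ?c)))))
      (insert (\<lambda>x. (f x \<and> ?p True x) \<or> (\<not> f x \<and> ?p False x)) ?F4)"
    by (rule computable_or) auto
  moreover have "(\<lambda>x. (f x \<and> ?p True x) \<or> (\<not> f x \<and> ?p False x)) = (\<lambda>x. \<phi> (map (\<lambda>f. f x) (f # fs)))"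
  proof
    fix x
    show "((f x \<and> ?p True x) \<or> (\<not> f x \<and> ?p False x)) = \<phi> (map (\<lambda>f. f x) (f # fs))"
      by (cases "f x") auto
  qed
  ultimately have *: "computable n (Suc (Suc (Suc (Suc (r + ?c + ?c)))))
      (insert (\<lambda>x. \<phi> (map (\<lambda>f. f x) (f # fs))) ?F4)"
    by simp
  have "(1::nat) \<le> ?c" by simp
  hence "Suc (Suc (Suc (Suc (r + ?c + ?c)))) \<le> r + 6 ^ length (f # fs)"
    by (simp only: length_Cons power_Suc)
  from * this show ?case
    by (rule computable_subset) auto
qed

lemma computable_truth_tables:
  assumes "computable n r (set fs)"
  shows "computable n (r + m * 6 ^ length fs)
    (set fs \<union> {\<lambda>x. \<phi> i (map (\<lambda>f. f x) fs) | i. i < m})"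
proof (induction m)
  case 0
  show ?case using assms by simp
next
  case (Suc m)
  have "computable n (r + m * 6 ^ length fs + 6 ^ length fs)
      (insert (\<lambda>x. \<phi> m (map (\<lambda>f. f x) fs))
        (set fs \<union> {\<lambda>x. \<phi> i (map (\<lambda>f. f x) fs) | i. i < m}))"
    by (rule computable_truth_table[OF Suc]) auto
  thus ?case
    by (rule computable_subset) (auto simp: less_Suc_eq)
qed

subsection \<open>Dyadic functions in binary\<close>

text \<open>The first output bit has weight 1, so \<open>Suc t\<close> bits also reach the value 1,
  the case \<open>v = 2 ^ t\<close>. Output \<open>i\<close> is the digit of \<open>v\<close> with
  place value \<open>2 ^ (Suc t - i)\<close>.\<close>

lemma dyadic_binary_expansion:
  assumes "v \<le> 2 ^ t"
  shows "real v / 2 ^ t = (\<Sum>i = 1..Suc t. of_bool (bit v (Suc t - i)) / 2 ^ (i - 1))"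
proof -
  have "v < 2 ^ Suc t"
    using assms by (simp add: less_le_trans le_less_trans)
  hence "v = take_bit (Suc t) v"
    by (simp add: take_bit_nat_eq_self)
  also have "\<dots> = (\<Sum>k = 0..<Suc t. of_bool (bit v k) * 2 ^ k)"
    unfolding take_bit_sum push_bit_eq_mult ..
  finally have "real v = real (\<Sum>k = 0..<Suc t. of_bool (bit v k) * 2 ^ k)"
    by (rule arg_cong)
  also have "\<dots> = (\<Sum>k = 0..<Suc t. of_bool (bit v k) * 2 ^ k)"
    by (simp only: of_nat_sum of_nat_mult of_nat_of_bool of_nat_power of_nat_numeral)
  also have "\<dots> = (\<Sum>i = 1..Suc t. of_bool (bit v (Suc t - i)) * 2 ^ (Suc t - i))"
    by (rule sum.reindex_bij_witness[of _ "\<lambda>i. Suc t - i" "\<lambda>i. Suc t - i"]) auto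
  finally have "real v / 2 ^ t = (\<Sum>i = 1..Suc t. of_bool (bit v (Suc t - i)) * (2 ^ (Suc t - i) / 2 ^ t))"
    by (simp only: sum_divide_distrib times_divide_eq_right)
  also have "\<dots> = (\<Sum>i = 1..Suc t. of_bool (bit v (Suc t - i)) / 2 ^ (i - 1))"
  proof (rule sum.cong[OF refl])
    fix i assume i: "i \<in> {1..Suc t}"
    hence "Suc t - i + (i - 1) = t" by auto
    hence "(2::real) ^ (Suc t - i) * 2 ^ (i - 1) = 2 ^ t"
      by (simp flip: power_add)
    thus "of_bool (bit v (Suc t - i)) * (2 ^ (Suc t - i) / 2 ^ t) =
        of_bool (bit v (Suc t - i)) / (2::real) ^ (i - 1)"
      by (simp add: field_simps)
  qed
  finally show ?thesis .
qed

lemma circuit_complexity_le: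
  assumes "computes_in_binary n c h" "circuit_size c \<le> s"
  shows "circuit_complexity n h \<le> enat s"
  unfolding circuit_complexity_def
  by (rule INF_lower2[of c]) (use assms in auto)

text \<open>Each of the \<open>Suc t\<close> binary digits of the numerator is a function of the
  bits \<open>fs\<close>, and gets its own truth table of at most \<open>6 ^ length fs\<close>
  gates.\<close>

lemma circuit_complexity_dyadic:
  assumes F: "computable n r (set fs)" and \<Psi>: "\<And>l. \<Psi> l \<le> 2 ^ t"
  shows "circuit_complexity n (\<lambda>x. real (\<Psi> (map (\<lambda>f. f x) fs)) / 2 ^ t)
    \<le> enat (n + r + Suc t * 6 ^ length fs)"
proof -
  let ?b = "\<lambda>i x. bit (\<Psi> (map (\<lambda>f. f x) fs)) i"
  obtain gs where gs: "valid_gates n gs" "length gs \<le> r + Suc t * 6 ^ length fs"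
    and "\<And>i. i < Suc t \<Longrightarrow> wire n gs (?b i)"
    using computable_truth_tables[OF F, of "Suc t" "\<lambda>i l. bit (\<Psi> l) i"]
    unfolding computable_def by auto
  then obtain w where w: "\<And>i. i < Suc t \<Longrightarrow> w i < n + length gs"
      "\<And>i x. i < Suc t \<Longrightarrow> x \<in> cube n \<Longrightarrow> run gs x ! w i = ?b i x"
    unfolding wire_def by metis
  \<comment> \<open>Most significant digit first: list positions count from 0 and position
    \<open>i\<close> holds digit \<open>t - i\<close>, whereas outputs are numbered from 1.\<close>
  define c where "c = Circuit n gs (map (\<lambda>i. w (t - i)) [0..<Suc t])"
  have out: "circuit_output c x i = ?b (Suc t - i) x" if "x \<in> cube n" "i \<in> {1..Suc t}" for x i
  proof -
    have "map (\<lambda>i. w (t - i)) [0..<Suc t] ! (i - 1) = w (t - (i - 1))"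
      using that by (subst nth_map) (auto simp del: upt_Suc)
    moreover have "t - (i - 1) = Suc t - i" "Suc t - i < Suc t"
      using that by auto
    ultimately show ?thesis
      using w(2)[of "Suc t - i" x] that
      by (simp add: circuit_output_def gate_values_def c_def run_def del: upt_Suc)
  qed
  have "computes_in_binary n c (\<lambda>x. real (\<Psi> (map (\<lambda>f. f x) fs)) / 2 ^ t)"
    unfolding computes_in_binary_def
  proof (intro exI[of _ "Suc t"] conjI ballI)
    show "is_circuit n (Suc t) c"
      using gs(1) w(1) by (auto simp: is_circuit_def c_def valid_gates_def simp del: upt_Suc)
    fix x assume x: "x \<in> cube n"
    show "real (\<Psi> (map (\<lambda>f. f x) fs)) / 2 ^ t
        = (\<Sum>i = 1..Suc t. of_bool (circuit_output c x i) / 2 ^ (i - 1))"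
      unfolding dyadic_binary_expansion[OF \<Psi>]
      by (rule sum.cong[OF refl]) (simp only: out[OF x])
  qed simp
  moreover have "circuit_size c \<le> n + r + Suc t * 6 ^ length fs"
    using gs(2) by (simp add: circuit_size_def c_def)
  ultimately show ?thesis
    by (rule circuit_complexity_le)
qed

text \<open>Serves the case \<open>s = n\<close>: a constant function would already need an inner
  gate, while an input bit is read off without any.\<close>

lemma circuit_complexity_projection:
  assumes "n \<ge> 1"
  shows "circuit_complexity n (\<lambda>x. of_bool (x ! 0)) \<le> enat n"
proof (rule circuit_complexity_le)
  show "computes_in_binary n (Circuit n [] [0]) (\<lambda>x. of_bool (x ! 0))"
    unfolding computes_in_binary_def using assms
    by (intro exI[of _ 1]) (auto simp: is_circuit_def circuit_output_def gate_values_def)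
qed (simp add: circuit_size_def)

subsection \<open>Advantage and mean square distance\<close>

lemma finite_cube [simp]: "finite (cube n)"
  and card_cube [simp]: "card (cube n) = 2 ^ n"
  using finite_lists_length_eq[of "UNIV :: bool set" n] card_lists_length_eq[of "UNIV :: bool set" n]
  by (simp_all add: cube_def)

lemma cube_nonempty [simp]: "cube n \<noteq> {}"
  using card_cube[of n] by (metis card.empty power_not_zero zero_neq_numeral)

text \<open>For fixed \<open>x\<close>, acceptance is affine in the label probability
  \<open>p x\<close>, and this is its coefficient.\<close>

definition slope :: "circuit \<Rightarrow> bool list \<Rightarrow> real" where
  "slope A x = of_bool (circuit_output A (x @ [True]) 1) - of_bool (circuit_output A (x @ [False]) 1)"

lemma abs_slope_le: "\<bar>slope A x\<bar> \<le> 1"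
  by (simp add: slope_def)

lemma acceptance_eq:
  assumes "\<And>x. x \<in> cube n \<Longrightarrow> 0 \<le> p x \<and> p x \<le> 1"
  shows "acceptance n A p =
    (\<Sum>x\<in>cube n. of_bool (circuit_output A (x @ [False]) 1) + p x * slope A x) / 2 ^ n"
proof -
  have "acceptance n A p = (\<Sum>x\<in>cube n. measure_pmf.expectation
      (map_pmf (\<lambda>y. (x, y)) (bernoulli_pmf (p x)))
      (\<lambda>(x, y). of_bool (circuit_output A (x @ [y]) 1)) /\<^sub>R real (card (cube n)))"
    unfolding acceptance_def labelled_pmf_def
    by (rule pmf_expectation_bind_pmf_of_set) auto
  also have "\<dots> = (\<Sum>x\<in>cube n. (of_bool (circuit_output A (x @ [False]) 1) + p x * slope A x) / 2 ^ n)"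
    by (rule sum.cong[OF refl])
      (use assms in \<open>auto simp: slope_def field_simps\<close>)
  finally show ?thesis
    by (simp add: sum_divide_distrib)
qed

text \<open>The constant terms of the two affine expressions cancel, so the advantage is a
  correlation with \<open>slope A\<close>.\<close>

lemma acceptance_diff:
  assumes "\<And>x. x \<in> cube n \<Longrightarrow> 0 \<le> p x \<and> p x \<le> 1" "\<And>x. x \<in> cube n \<Longrightarrow> 0 \<le> q x \<and> q x \<le> 1"
  shows "acceptance n A p - acceptance n A q = (\<Sum>x\<in>cube n. (p x - q x) * slope A x) / 2 ^ n"
  unfolding acceptance_eq[of n p, OF assms(1), simplified] acceptance_eq[of n q, OF assms(2), simplified]
  by (simp add: sum.distrib algebra_simps sum_subtractf flip: diff_divide_distrib)

text \<open>Bounds the advantage of all circuits regardless of size, which settles large \<epsilon>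
  without any iteration.\<close>

lemma acceptance_diff_le:
  assumes "\<And>x. x \<in> cube n \<Longrightarrow> 0 \<le> p x \<and> p x \<le> 1" "\<And>x. x \<in> cube n \<Longrightarrow> 0 \<le> q x \<and> q x \<le> 1"
    and "\<And>x. x \<in> cube n \<Longrightarrow> \<bar>p x - q x\<bar> \<le> d"
  shows "\<bar>acceptance n A p - acceptance n A q\<bar> \<le> d"
proof -
  have "\<bar>\<Sum>x\<in>cube n. (p x - q x) * slope A x\<bar> \<le> (\<Sum>x\<in>cube n. \<bar>(p x - q x) * slope A x\<bar>)"
    by (rule sum_abs)
  also have "\<dots> \<le> (\<Sum>x\<in>cube n. d)"
  proof (rule sum_mono)
    fix x assume "x \<in> cube n"
    hence "\<bar>p x - q x\<bar> * \<bar>slope A x\<bar> \<le> d * 1"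
      using assms(3)[of x] abs_slope_le[of A x] by (intro mult_mono) auto
    thus "\<bar>(p x - q x) * slope A x\<bar> \<le> d"
      by (simp add: abs_mult)
  qed
  finally have "\<bar>\<Sum>x\<in>cube n. (p x - q x) * slope A x\<bar> \<le> d * 2 ^ n"
    by (simp add: mult.commute)
  moreover have "acceptance n A p - acceptance n A q = (\<Sum>x\<in>cube n. (p x - q x) * slope A x) / 2 ^ n"
    using assms(1,2) by (rule acceptance_diff)
  ultimately show ?thesis
    by (simp add: divide_le_eq)
qed

definition sq_dist :: "nat \<Rightarrow> (bool list \<Rightarrow> bool) \<Rightarrow> (bool list \<Rightarrow> real) \<Rightarrow> real" where
  "sq_dist n g h = (\<Sum>x\<in>cube n. (of_bool (g x) - h x)\<^sup>2) / 2 ^ n"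

lemma sq_dist_nonneg: "0 \<le> sq_dist n g h"
  by (simp add: sq_dist_def sum_nonneg)

text \<open>Acts on numerators over \<open>m\<close>, so a step has length \<open>1 / m\<close>. The
  flags stand for a distinguisher's answers on the two labels; \<open>min m\<close> clips the value
  at 1 and truncated subtraction clips it at 0.\<close>

definition clipped_step :: "nat \<Rightarrow> bool \<Rightarrow> bool \<Rightarrow> nat \<Rightarrow> nat" where
  "clipped_step m up down v =
     (if up \<and> \<not> down then min m (Suc v) else if down \<and> \<not> up then v - 1 else v)"

lemma clipped_step_le: "v \<le> m \<Longrightarrow> clipped_step m up down v \<le> m"
  by (auto simp: clipped_step_def)

lemma clipped_step_sq_dist:
  fixes b :: bool and m v :: nat
  assumes "v \<le> m" "m > 0"
  shows "(of_bool b - real (clipped_step m up down v) / m)\<^sup>2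
    \<le> (of_bool b - real v / m)\<^sup>2 - 2 / m * ((of_bool b - real v / m) * (of_bool up - of_bool down))
      + (1 / m)\<^sup>2"
proof -
  let ?d = "of_bool up - of_bool down :: real"
  let ?B = "real m * of_bool b"
  have "(?B - real (clipped_step m up down v))\<^sup>2 \<le> (?B - v)\<^sup>2 - 2 * ((?B - v) * ?d) + 1"
  proof (cases "up = down")
    case True
    thus ?thesis by (simp add: clipped_step_def)
  next
    case False
    \<comment> \<open>The target \<open>?B\<close> is 0 or \<open>m\<close>, so clipping to the
      interval from 0 to \<open>m\<close> never moves a value away from it.\<close>
    hence "\<bar>?B - real (clipped_step m up down v)\<bar> \<le> \<bar>?B - v - ?d\<bar>"
      using assms by (cases v; cases b; cases up) (auto simp: clipped_step_def min_def)
    hence "(?B - real (clipped_step m up down v))\<^sup>2 \<le> (?B - v - ?d)\<^sup>2"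
      by (rule abs_le_square_iff[THEN iffD1])
    also have "\<dots> = (?B - v)\<^sup>2 - 2 * ((?B - v) * ?d) + ?d\<^sup>2"
      by (simp add: power2_eq_square algebra_simps)
    also have "?d\<^sup>2 = 1"
      using False by (cases up; cases down) auto
    finally show ?thesis .
  qed
  hence "(?B - real (clipped_step m up down v))\<^sup>2 / (real m)\<^sup>2
      \<le> ((?B - v)\<^sup>2 - 2 * ((?B - v) * ?d) + 1) / (real m)\<^sup>2"
    by (rule divide_right_mono) simp
  moreover have "(u\<^sup>2 - 2 * (u * ?d) + 1) / (real m)\<^sup>2 = (u / m)\<^sup>2 - 2 / m * (u / m * ?d) + (1 / m)\<^sup>2"
    for u :: real
    by (simp add: power2_eq_square add_divide_distrib diff_divide_distrib)
  moreover have "of_bool b - real u / m = (?B - u) / m" for u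
    using assms(2) by (simp add: diff_divide_distrib)
  ultimately show ?thesis
    by (simp only: power_divide)
qed

lemma sq_dist_clipped_step:
  fixes H :: "bool list \<Rightarrow> nat"
  assumes H: "\<And>x. H x \<le> m" and m: "m > 0" "1 / m \<le> \<epsilon>" "\<epsilon> \<le> 2 / m"
    and corr: "(\<Sum>x\<in>cube n. (of_bool (g x) - real (H x) / m) * (of_bool (up x) - of_bool (down x))) / 2 ^ n > \<epsilon>"
  shows "sq_dist n g (\<lambda>x. real (clipped_step m (up x) (down x) (H x)) / m)
    \<le> sq_dist n g (\<lambda>x. real (H x) / m) - 3 / 4 * \<epsilon>\<^sup>2"
proof -
  let ?\<gamma> = "1 / real m"
  let ?S = "\<Sum>x\<in>cube n. (of_bool (g x) - real (H x) / m) * (of_bool (up x) - of_bool (down x))"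
  have "(\<Sum>x\<in>cube n. (of_bool (g x) - real (clipped_step m (up x) (down x) (H x)) / m)\<^sup>2)
    \<le> (\<Sum>x\<in>cube n. (of_bool (g x) - real (H x) / m)\<^sup>2
        - 2 / m * ((of_bool (g x) - real (H x) / m) * (of_bool (up x) - of_bool (down x))) + (1 / m)\<^sup>2)"
    by (rule sum_mono, rule clipped_step_sq_dist[OF H m(1)])
  also have "\<dots> = (\<Sum>x\<in>cube n. (of_bool (g x) - real (H x) / m)\<^sup>2) - 2 / m * ?S + 2 ^ n * (1 / m)\<^sup>2"
    by (simp only: sum.distrib sum_subtractf sum_distrib_left sum_constant card_cube) simp
  finally have "sq_dist n g (\<lambda>x. real (clipped_step m (up x) (down x) (H x)) / m)
    \<le> ((\<Sum>x\<in>cube n. (of_bool (g x) - real (H x) / m)\<^sup>2) - 2 / m * ?S + 2 ^ n * (1 / m)\<^sup>2) / 2 ^ n"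
    unfolding sq_dist_def by (rule divide_right_mono) simp
  also have "\<dots> = sq_dist n g (\<lambda>x. real (H x) / m) - 2 * ?\<gamma> * (?S / 2 ^ n) + ?\<gamma>\<^sup>2"
    by (simp add: sq_dist_def add_divide_distrib diff_divide_distrib)
  also have "\<dots> \<le> sq_dist n g (\<lambda>x. real (H x) / m) - 2 * ?\<gamma> * \<epsilon> + ?\<gamma>\<^sup>2"
    using mult_left_mono[of \<epsilon> "?S / 2 ^ n" "2 * ?\<gamma>"] corr by simp
  also have "2 * ?\<gamma> * \<epsilon> - ?\<gamma>\<^sup>2 \<ge> 3 / 4 * \<epsilon>\<^sup>2"
  proof -
    \<comment> \<open>With \<gamma> between \<epsilon>/2 and \<epsilon>, this product gives
      \<open>3/2 * \<gamma> * \<epsilon> - \<gamma>\<^sup>2 \<ge> \<epsilon>\<^sup>2 / 2\<close>;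
      the remaining \<open>\<gamma> * \<epsilon> / 2\<close> contributes at least
      \<open>\<epsilon>\<^sup>2 / 4\<close>.\<close>
    have "0 \<le> (\<epsilon> - ?\<gamma>) * (?\<gamma> - \<epsilon> / 2)"
      using m by (intro mult_nonneg_nonneg) auto
    moreover have "?\<gamma> * \<epsilon> \<ge> \<epsilon> / 2 * \<epsilon>"
      using m by (intro mult_right_mono) (auto intro: order_trans[of 0 "1 / real m"])
    ultimately show ?thesis
      by (simp add: power2_eq_square algebra_simps)
  qed
  hence "sq_dist n g (\<lambda>x. real (H x) / m) - 2 * ?\<gamma> * \<epsilon> + ?\<gamma>\<^sup>2
      \<le> sq_dist n g (\<lambda>x. real (H x) / m) - 3 / 4 * \<epsilon>\<^sup>2"
    by linarith
  finally show ?thesis .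
qed

subsection \<open>The iteration\<close>

text \<open>The invariant after \<open>i\<close> rounds. Every round adds two bits to
  \<open>fs\<close>, and \<open>h\<close> is tabulated afresh from all of them, so
  \<open>36 ^ i\<close> is the table cost \<open>6 ^ (2 * i)\<close> per digit. As \<open>s\<close>
  is only an upper bound, it can be given a convenient closed form.\<close>

definition stage :: "nat \<Rightarrow> (bool list \<Rightarrow> bool) \<Rightarrow> real \<Rightarrow> nat \<Rightarrow> nat \<Rightarrow> nat \<Rightarrow> (bool list \<Rightarrow> real) \<Rightarrow> bool" where
  "stage n g \<epsilon> t i s h \<longleftrightarrow>
     (\<exists>fs r \<Psi>. computable n r (set fs) \<and> length fs = 2 * i \<and> (\<forall>l. \<Psi> l \<le> (2::nat) ^ t) \<and>
        n + r + Suc t * 36 ^ i \<le> s \<and> h = (\<lambda>x. real (\<Psi> (map (\<lambda>f. f x) fs)) / 2 ^ t) \<and>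
        sq_dist n g h \<le> 1 / 4 - real i * (3 / 4 * \<epsilon>\<^sup>2))"

lemma stage_bounds:
  assumes "stage n g \<epsilon> t i s h"
  shows "0 \<le> h x \<and> h x \<le> 1" "circuit_complexity n h \<le> enat s" "n \<le> s"
    "3 * real i * \<epsilon>\<^sup>2 \<le> 1"
proof -
  obtain fs r \<Psi> where *: "computable n r (set fs)" "length fs = 2 * i" "\<And>l. \<Psi> l \<le> (2::nat) ^ t"
    "n + r + Suc t * 36 ^ i \<le> s" "h = (\<lambda>x. real (\<Psi> (map (\<lambda>f. f x) fs)) / 2 ^ t)"
    "sq_dist n g h \<le> 1 / 4 - real i * (3 / 4 * \<epsilon>\<^sup>2)"
    using assms unfolding stage_def by blast
  have "real (\<Psi> l) \<le> 2 ^ t" for l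
    using *(3)[of l] by (metis of_nat_le_iff of_nat_numeral of_nat_power)
  thus "0 \<le> h x \<and> h x \<le> 1"
    unfolding *(5) by simp
  have "circuit_complexity n h \<le> enat (n + r + Suc t * 6 ^ length fs)"
    unfolding *(5) by (rule circuit_complexity_dyadic[OF *(1,3)])
  also have "\<dots> \<le> enat s"
    using *(4) by (simp add: *(2) power_mult)
  finally show "circuit_complexity n h \<le> enat s" .
  show "n \<le> s" using *(4) by simp
  \<comment> \<open>The mean square distance cannot become negative, which limits the number of
    rounds.\<close>
  show "3 * real i * \<epsilon>\<^sup>2 \<le> 1"
    using *(6) sq_dist_nonneg[of n g h] by simp
qed

lemma stage_0:
  assumes "t \<ge> 1"
  shows "stage n g \<epsilon> t 0 (n + Suc t) (\<lambda>x. 1 / 2)"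
proof -
  \<comment> \<open>The starting value 1/2 is a multiple of the step only for
    \<open>t \<ge> 1\<close>.\<close>
  have half: "(1::real) / 2 = real (2 ^ (t - 1)) / 2 ^ t"
    using assms by (cases t) auto
  have "(of_bool b - 1 / 2 :: real)\<^sup>2 = 1 / 4" for b
    by (cases b) (auto simp: power2_eq_square)
  hence "sq_dist n g (\<lambda>x. 1 / 2) \<le> 1 / 4"
    by (simp only: sq_dist_def sum_constant card_cube) simp
  thus ?thesis
    unfolding stage_def using computable_empty[of n] half
    by (intro exI[of _ "[]"] exI[of _ 0] exI[of _ "\<lambda>_. 2 ^ (t - 1)"]) auto
qed

lemma stage_Suc:
  assumes st: "stage n g \<epsilon> t i s h"
    and t: "1 / 2 ^ t \<le> \<epsilon>" "\<epsilon> \<le> 2 / 2 ^ t"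
    and A: "is_circuit (Suc n) 1 A" "circuit_size A \<le> s ^ k"
    and adv: "\<bar>acceptance n A (\<lambda>x. of_bool (g x)) - acceptance n A h\<bar> > \<epsilon>"
    and s': "36 * s + 2 * s ^ k \<le> s'"
  shows "\<exists>h'. stage n g \<epsilon> t (Suc i) s' h'"
proof -
  obtain fs r \<Psi> where *: "computable n r (set fs)" "length fs = 2 * i" "\<And>l. \<Psi> l \<le> (2::nat) ^ t"
    "n + r + Suc t * 36 ^ i \<le> s" "h = (\<lambda>x. real (\<Psi> (map (\<lambda>f. f x) fs)) / 2 ^ t)"
    "sq_dist n g h \<le> 1 / 4 - real i * (3 / 4 * \<epsilon>\<^sup>2)"
    using st unfolding stage_def by blast
  define b where "b = (\<lambda>y x. circuit_output A (x @ [y]) 1)"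
  \<comment> \<open>The flag \<open>y\<close> fixes the direction of the step: exchanging the two
    labels flips the sign of the correlation, which disposes of the absolute value.\<close>
  define cor where "cor = (\<lambda>y. (\<Sum>x\<in>cube n. (of_bool (g x) - h x)
      * (of_bool (b y x) - of_bool (b (\<not> y) x))) / 2 ^ n)"
  have "acceptance n A (\<lambda>x. of_bool (g x)) - acceptance n A h = cor True"
    using acceptance_diff[of n "\<lambda>x. of_bool (g x)" h A] stage_bounds(1)[OF st]
    by (simp add: cor_def slope_def b_def)
  moreover have "cor False = - cor True"
  proof -
    have "(\<Sum>x\<in>cube n. (of_bool (g x) - h x) * (of_bool (b False x) - of_bool (b True x)))
        = (\<Sum>x\<in>cube n. - ((of_bool (g x) - h x) * (of_bool (b True x) - of_bool (b False x))))"
      by (rule sum.cong[OF refl]) (simp only: mult_minus_right[symmetric] minus_diff_eq)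
    thus ?thesis
      by (simp only: cor_def sum_negf minus_divide_left not_True_eq_False not_False_eq_True)
  qed
  ultimately obtain y where y: "cor y > \<epsilon>"
    using adv by (metis abs_if)
  let ?fs = "b y # b (\<not> y) # fs"
  define \<Psi>' where "\<Psi>' = (\<lambda>l. clipped_step (2 ^ t) (hd l) (hd (tl l)) (\<Psi> (tl (tl l))))"
  let ?h = "\<lambda>x. real (\<Psi>' (map (\<lambda>f. f x) ?fs)) / 2 ^ t"
  have "computable n (r + (s ^ k - n) + (s ^ k - n)) (insert (b y) (insert (b (\<not> y)) (set fs)))"
    unfolding b_def by (intro computable_fix_last_input *(1) A)
  hence 1: "computable n (r + 2 * s ^ k) (set ?fs)"
    by (rule computable_subset) auto
  \<comment> \<open>Two more bits multiply the table cost by 36; the whole old bound is multiplied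
    along with it so that it can be replaced by \<open>s\<close>.\<close>
  have 2: "n + (r + 2 * s ^ k) + Suc t * 36 ^ Suc i \<le> s'"
  proof -
    have "n + (r + 2 * s ^ k) + Suc t * 36 ^ Suc i \<le> 36 * (n + r + Suc t * 36 ^ i) + 2 * s ^ k"
      by (simp add: algebra_simps)
    also have "\<dots> \<le> 36 * s + 2 * s ^ k"
      using *(4) by (intro add_right_mono mult_left_mono) auto
    finally show ?thesis using s' by simp
  qed
  have "sq_dist n g ?h \<le> sq_dist n g h - 3 / 4 * \<epsilon>\<^sup>2"
    using sq_dist_clipped_step[where H = "\<lambda>x. \<Psi> (map (\<lambda>f. f x) fs)" and m = "2 ^ t" and \<epsilon> = \<epsilon>
        and n = n and g = g and up = "b y" and down = "b (\<not> y)"] *(3) t y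
    by (simp add: \<Psi>'_def *(5) cor_def)
  hence 3: "sq_dist n g ?h \<le> 1 / 4 - real (Suc i) * (3 / 4 * \<epsilon>\<^sup>2)"
    using *(6) by (simp only: of_nat_Suc distrib_right mult_1_left)
  have 4: "\<forall>l. \<Psi>' l \<le> 2 ^ t"
    unfolding \<Psi>'_def using *(3) clipped_step_le by blast
  have "stage n g \<epsilon> t (Suc i) s' ?h"
    unfolding stage_def
    by (intro exI[of _ ?fs] exI[of _ "r + 2 * s ^ k"] exI[of _ \<Psi>'] conjI 1 2 3 4)
      (simp_all add: *(2))
  thus ?thesis by (rule exI[of _ ?h])
qed

text \<open>From \<open>5 * s \<le> s ^ k\<close> the left side is at most
  \<open>10 * s ^ k\<close>, whereas \<open>25 * s ^ k \<le> s ^ (2 + k)\<close> and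
  \<open>2 + k \<le> k\<^sup>2\<close>.\<close>

lemma stage_growth:
  fixes s k :: nat
  assumes "s \<ge> 5" "k \<ge> 2"
  shows "36 * s + 2 * s ^ k \<le> s ^ k\<^sup>2"
proof -
  have "5 * s \<le> s ^ 2"
    using assms(1) by (simp add: power2_eq_square)
  also have "\<dots> \<le> s ^ k"
    using assms by (intro power_increasing) auto
  finally have 1: "5 * s \<le> s ^ k" .
  have "5 ^ 2 * s ^ k \<le> s ^ 2 * s ^ k"
    using assms(1) by (intro mult_right_mono power_mono) auto
  also have "\<dots> = s ^ (2 + k)"
    by (simp only: power_add)
  also have "\<dots> \<le> s ^ k\<^sup>2"
  proof (rule power_increasing)
    have "2 + k \<le> k + k" using assms(2) by simp
    also have "\<dots> \<le> k\<^sup>2" using assms(2) mult_le_mono1[of 2 k k] unfolding power2_eq_square by linarith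
    finally show "2 + k \<le> k\<^sup>2" .
  qed (use assms in auto)
  finally show ?thesis using 1 by simp
qed

text \<open>If every stage had a distinguisher, stages would exist for all \<open>i\<close>, against
  the bound on the number of rounds. A round raises the size bound to the power
  \<open>k\<^sup>2\<close>, hence the exponent \<open>k ^ (2 * i)\<close>.\<close>

lemma exists_fooling_stage:
  fixes k t :: nat
  assumes t: "t \<ge> 2" "1 / 2 ^ t \<le> \<epsilon>" "\<epsilon> \<le> 2 / 2 ^ t" and n: "n \<ge> 2" and k: "k \<ge> 2"
  defines "s \<equiv> \<lambda>i. (n + Suc t) ^ k ^ (2 * i)"
  shows "\<exists>i h. stage n g \<epsilon> t i (s i) h \<and>
    (\<forall>A. is_circuit (n + 1) 1 A \<longrightarrow> circuit_size A \<le> s i ^ k \<longrightarrow>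
       \<bar>acceptance n A (\<lambda>x. of_bool (g x)) - acceptance n A h\<bar> \<le> \<epsilon>)"
proof (rule ccontr)
  assume contra: "\<not> ?thesis"
  have "0 < \<epsilon>"
    using t(2) by (rule less_le_trans[rotated]) simp
  have s_ge: "s i \<ge> 5" for i
  proof -
    have "5 \<le> (n + Suc t) ^ 1" using t n by simp
    also have "\<dots> \<le> s i"
      unfolding s_def using k by (intro power_increasing) auto
    finally show ?thesis .
  qed
  have s_Suc: "s (Suc i) = s i ^ k\<^sup>2" for i
    by (simp add: s_def power_add power2_eq_square flip: power_mult) (simp add: mult_ac)
  have all: "\<exists>h. stage n g \<epsilon> t i (s i) h" for i
  proof (induction i)
    case 0
    show ?case using stage_0[of t n g \<epsilon>] t(1) by (auto simp: s_def)
  next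
    case (Suc i)
    then obtain h where h: "stage n g \<epsilon> t i (s i) h" ..
    with contra obtain A where "is_circuit (n + 1) 1 A" "circuit_size A \<le> s i ^ k"
      "\<bar>acceptance n A (\<lambda>x. of_bool (g x)) - acceptance n A h\<bar> > \<epsilon>"
      by (meson not_le)
    moreover have "36 * s i + 2 * s i ^ k \<le> s (Suc i)"
      unfolding s_Suc by (rule stage_growth[OF s_ge k])
    ultimately show ?case
      using stage_Suc[OF h t(2,3)] by simp
  qed
  obtain i where "real i > 1 / (3 * \<epsilon>\<^sup>2)"
    using reals_Archimedean2 by blast
  moreover obtain h where "stage n g \<epsilon> t i (s i) h"
    using all by blast
  ultimately show False
    using stage_bounds(4) \<open>0 < \<epsilon>\<close> by (fastforce simp: field_simps)
qed

section \<open>Numerical estimates: the final size and the dyadic step\<close>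

lemma final_size_bound:
  fixes n k t i :: nat and \<epsilon> :: real
  assumes "0 < \<epsilon>" "\<epsilon> < 1 / 2" "n \<ge> 2" "k \<ge> 2" "3 * real i * \<epsilon>\<^sup>2 \<le> 1"
    and t: "real t \<le> log 2 (1 / \<epsilon>) + 1"
  shows "real ((n + Suc t) ^ k ^ (2 * i)) \<le> (real n + log 2 (1 / \<epsilon>)) powr (real k powr (1 / \<epsilon>\<^sup>2))"
proof -
  define B where "B = real n + log 2 (1 / \<epsilon>)"
  have "log 2 (1 / \<epsilon>) > log 2 2"
    using assms(1,2) by (subst log_less_cancel_iff) (auto simp: field_simps)
  hence B: "B \<ge> 3"
    using assms(3) by (simp add: B_def)
  have "real (n + Suc t) \<le> B + 2"
    using t by (simp add: B_def)
  \<comment> \<open>Squaring the base absorbs the rounding of \<open>t\<close> and the additive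
    constant; the price is a factor 2 in the exponent, which \<open>k \<ge> 2\<close> absorbs into
    one more power of \<open>k\<close>.\<close>
  also have "\<dots> \<le> B\<^sup>2"
    using mult_right_mono[of 3 B B] B unfolding power2_eq_square by linarith
  finally have "real (n + Suc t) ^ k ^ (2 * i) \<le> (B\<^sup>2) ^ k ^ (2 * i)"
    by (rule power_mono) simp
  also have "\<dots> = B ^ (2 * k ^ (2 * i))"
    by (rule power_mult[symmetric])
  also have "\<dots> = B powr real (2 * k ^ (2 * i))"
    using B by (intro powr_realpow[symmetric]) auto
  also have "\<dots> = B powr (2 * real k ^ (2 * i))"
    by simp
  also have "\<dots> \<le> B powr (real k powr (1 / \<epsilon>\<^sup>2))"
  proof (rule powr_mono)
    have "4 * \<epsilon>\<^sup>2 \<le> 1"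
      using power_mono[of \<epsilon> "1 / 2" 2] assms(1,2) by (simp add: power_divide)
    \<comment> \<open>Here \<open>2 * i * \<epsilon>\<^sup>2 \<le> 2/3\<close> and
      \<open>\<epsilon>\<^sup>2 \<le> 1/4\<close>, with sum \<open>11/12 \<le> 1\<close>.\<close>
    hence e: "1 + 2 * real i \<le> 1 / \<epsilon>\<^sup>2"
      using assms(1,5) by (simp add: field_simps)
    have "2 * real k ^ (2 * i) \<le> real k * real k ^ (2 * i)"
      using assms(4) by (intro mult_right_mono) auto
    also have "\<dots> = real k ^ (1 + 2 * i)"
      by simp
    also have "\<dots> = real k powr real (1 + 2 * i)"
      using assms(4) by (intro powr_realpow[symmetric]) auto
    also have "\<dots> = real k powr (1 + 2 * real i)"
      by simp
    also have "\<dots> \<le> real k powr (1 / \<epsilon>\<^sup>2)"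
      using assms(4) e by (intro powr_mono) auto
    finally show "2 * real k ^ (2 * i) \<le> real k powr (1 / \<epsilon>\<^sup>2)" .
  qed (use B in auto)
  finally show ?thesis
    by (simp add: B_def)
qed

lemma dyadic_step_exponent:
  fixes \<epsilon> :: real
  assumes "0 < \<epsilon>" "\<epsilon> < 1 / 2"
  obtains t :: nat where "t \<ge> 2" "1 / 2 ^ t \<le> \<epsilon>" "\<epsilon> \<le> 2 / 2 ^ t" "real t \<le> log 2 (1 / \<epsilon>) + 1"
proof -
  define L where "L = log 2 (1 / \<epsilon>)"
  \<comment> \<open>Rounding the logarithm up puts \<open>1 / 2 ^ t\<close> between \<epsilon>/2 and
    \<epsilon>; \<open>\<epsilon> < 1 / 2\<close> forces \<open>L > 1\<close>, hence
    \<open>t \<ge> 2\<close>.\<close>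
  define t where "t = nat \<lceil>L\<rceil>"
  have "L > log 2 2"
    unfolding L_def using assms by (subst log_less_cancel_iff) (auto simp: field_simps)
  hence L: "L > 1" by simp
  hence t: "t \<ge> 2" "L \<le> real t" "real t \<le> L + 1"
    unfolding t_def by linarith+
  have eps: "2 powr L = 1 / \<epsilon>"
    unfolding L_def using assms by (intro powr_log_cancel) auto
  have pow: "2 powr real t = 2 ^ t"
    by (rule powr_realpow) simp
  have "2 powr L \<le> 2 powr real t"
    using t(2) by (intro powr_mono) auto
  hence lower: "1 / \<epsilon> \<le> 2 ^ t"
    unfolding eps pow .
  have "2 powr real t \<le> 2 powr (L + 1)"
    using t(3) by (intro powr_mono) auto
  hence upper: "2 ^ t \<le> 1 / \<epsilon> * 2"
    unfolding powr_add eps pow by simp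
  have "1 / 2 ^ t \<le> \<epsilon>"
    using lower assms(1) by (simp add: divide_le_eq mult.commute)
  moreover have "\<epsilon> \<le> 2 / 2 ^ t"
    using upper assms(1) by (simp add: le_divide_eq mult.commute)
  ultimately show thesis
    using that t(1,3) by (simp add: L_def)
qed

section \<open>Degenerate parameter ranges and the general case\<close>

theorem theorem1p2:
  "\<exists>C::real. C > 0 \<and>
     (\<forall>(n::nat) (g :: bool list \<Rightarrow> bool) (k::nat) (\<epsilon>::real).
        n \<ge> 1 \<longrightarrow> k \<ge> 1 \<longrightarrow> \<epsilon> > 0 \<longrightarrow>
        (\<exists>(s::nat) (h :: bool list \<Rightarrow> real).
           n \<le> s \<and>
           real s \<le> (real n + (log 2 (1 / \<epsilon>)) powr C) powr (real k powr (1 / \<epsilon>\<^sup>2)) \<and>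
           (\<forall>x\<in>cube n. 0 \<le> h x \<and> h x \<le> 1) \<and>
           circuit_complexity n h \<le> enat s \<and>
           (\<forall>A. is_circuit (n + 1) 1 A \<longrightarrow> circuit_size A \<le> s ^ k \<longrightarrow>
              \<bar>acceptance n A (\<lambda>x. of_bool (g x)) - acceptance n A h\<bar> \<le> \<epsilon>)))"
proof (intro exI[of _ "1::real"] conjI allI impI)
  fix n k :: nat and g :: "bool list \<Rightarrow> bool" and \<epsilon> :: real
  assume n: "n \<ge> 1" and k: "k \<ge> 1" and \<epsilon>: "\<epsilon> > 0"
  let ?B = "(real n + (log 2 (1 / \<epsilon>)) powr 1) powr (real k powr (1 / \<epsilon>\<^sup>2))"
  \<comment> \<open>For \<epsilon> \<ge> 1 the logarithm is not positive, but \<open>powr\<close> is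
    never negative.\<close>
  have base: "real n \<le> real n + (log 2 (1 / \<epsilon>)) powr 1"
    by simp
  have B_ge: "real n ^ j \<le> ?B" if "real j \<le> real k powr (1 / \<epsilon>\<^sup>2)" for j
  proof -
    have "real n ^ j = real n powr real j"
      using n by (simp add: powr_realpow)
    also have "\<dots> \<le> real n powr (real k powr (1 / \<epsilon>\<^sup>2))"
      using n that by (intro powr_mono) auto
    also have "\<dots> \<le> ?B"
      using base by (intro powr_mono2) auto
    finally show ?thesis .
  qed
  \<comment> \<open>In the first case no admissible circuit exists or \<epsilon> \<ge> 1 makes the
    claim trivial, so \<open>s = n\<close> works; in the second the constant 1/2 is good enough;
    only the third needs the iteration.\<close>
  consider "n = 1 \<or> k = 1 \<or> \<epsilon> \<ge> 1" | "n \<ge> 2" "k \<ge> 2" "1 / 2 \<le> \<epsilon>" "\<epsilon> < 1"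
    | "n \<ge> 2" "k \<ge> 2" "\<epsilon> < 1 / 2"
    using n k by fastforce
  thus "\<exists>s h. n \<le> s \<and> real s \<le> ?B \<and> (\<forall>x\<in>cube n. 0 \<le> h x \<and> h x \<le> 1) \<and>
      circuit_complexity n h \<le> enat s \<and>
      (\<forall>A. is_circuit (n + 1) 1 A \<longrightarrow> circuit_size A \<le> s ^ k \<longrightarrow>
        \<bar>acceptance n A (\<lambda>x. of_bool (g x)) - acceptance n A h\<bar> \<le> \<epsilon>)"
  proof cases
    case 1
    show ?thesis
    proof (intro exI[of _ n] exI[of _ "\<lambda>x. of_bool (x ! 0)"] conjI allI impI)
      show "real n \<le> ?B"
        using B_ge[of 1] k by (simp add: ge_one_powr_ge_zero)
      show "circuit_complexity n (\<lambda>x. of_bool (x ! 0)) \<le> enat n"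
        using n by (rule circuit_complexity_projection)
      fix A assume A: "is_circuit (n + 1) 1 A" "circuit_size A \<le> n ^ k"
      \<comment> \<open>the input gates alone exceed the size \<open>n ^ k\<close> if \<open>n = 1\<close> or \<open>k = 1\<close>\<close>
      hence "n + 1 \<le> n ^ k"
        by (simp add: is_circuit_def circuit_size_def)
      hence "\<epsilon> \<ge> 1" using 1 by auto
      moreover have "\<bar>acceptance n A (\<lambda>x. of_bool (g x)) - acceptance n A (\<lambda>x. of_bool (x ! 0))\<bar> \<le> 1"
        by (rule acceptance_diff_le) auto
      ultimately show "\<bar>acceptance n A (\<lambda>x. of_bool (g x)) - acceptance n A (\<lambda>x. of_bool (x ! 0))\<bar> \<le> \<epsilon>"
        by simp
    qed auto
  next
    case 2
    have st: "stage n g \<epsilon> 1 0 (n + Suc 1) (\<lambda>x. 1 / 2)"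
      by (rule stage_0) simp
    show ?thesis
    proof (intro exI[of _ "n + Suc 1"] exI[of _ "\<lambda>x. 1 / 2"] conjI allI impI)
      \<comment> \<open>The exponent in the size bound is thus at least \<open>k \<ge> 2\<close>,
        which leaves room for \<open>n + 2 \<le> n ^ 2\<close>.\<close>
      have "1 \<le> 1 / \<epsilon>\<^sup>2"
        using 2 \<epsilon> by (simp add: power_le_one)
      hence "real k powr 1 \<le> real k powr (1 / \<epsilon>\<^sup>2)"
        using 2 by (intro powr_mono) auto
      hence "real n ^ 2 \<le> ?B"
        using 2 by (intro B_ge) auto
      moreover have "n + Suc 1 \<le> n ^ 2"
        using mult_le_mono1[OF 2(1), of n] 2(1) unfolding power2_eq_square by linarith
      hence "real (n + Suc 1) \<le> real n ^ 2"
        by (metis of_nat_le_iff of_nat_power)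
      ultimately show "real (n + Suc 1) \<le> ?B" by linarith
      show "circuit_complexity n (\<lambda>x. 1 / 2) \<le> enat (n + Suc 1)"
        by (rule stage_bounds(2)[OF st])
      fix A
      have "\<bar>of_bool b - 1 / 2 :: real\<bar> \<le> 1 / 2" for b
        by (cases b) auto
      hence "\<bar>acceptance n A (\<lambda>x. of_bool (g x)) - acceptance n A (\<lambda>x. 1 / 2)\<bar> \<le> 1 / 2"
        by (intro acceptance_diff_le) auto
      thus "\<bar>acceptance n A (\<lambda>x. of_bool (g x)) - acceptance n A (\<lambda>x. 1 / 2)\<bar> \<le> \<epsilon>"
        using 2 by simp
    qed auto
  next
    case 3
    obtain t :: nat where t: "t \<ge> 2" "1 / 2 ^ t \<le> \<epsilon>" "\<epsilon> \<le> 2 / 2 ^ t" "real t \<le> log 2 (1 / \<epsilon>) + 1"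
      using dyadic_step_exponent[OF \<epsilon> 3(3)] .
    obtain i h where st: "stage n g \<epsilon> t i ((n + Suc t) ^ k ^ (2 * i)) h"
      and fool: "\<forall>A. is_circuit (n + 1) 1 A \<longrightarrow> circuit_size A \<le> ((n + Suc t) ^ k ^ (2 * i)) ^ k \<longrightarrow>
       \<bar>acceptance n A (\<lambda>x. of_bool (g x)) - acceptance n A h\<bar> \<le> \<epsilon>"
      using exists_fooling_stage[OF t(1-3) 3(1,2)] by blast
    \<comment> \<open>Positivity makes \<open>powr 1\<close> the identity on the logarithm.\<close>
    have "log 2 (1 / \<epsilon>) > 0"
      using \<epsilon> 3 by (simp add: field_simps)
    hence "real ((n + Suc t) ^ k ^ (2 * i)) \<le> ?B"
      using final_size_bound[OF \<epsilon> 3(3,1,2) stage_bounds(4)[OF st] t(4)] by simp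
    with stage_bounds[OF st] fool show ?thesis
      by blast
  qed
qed simp

end
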